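(* Let $\mathbf L=(L,\vee,\wedge,{}^*,0,1)$ be a complete pseudocomplemented lattice. Then $\mathbf{Cl}(\mathbf L)=(\mathrm{Cl}(\mathbf L),\vee,\cap,{}^\perp,\{0\},L)$ is a complete Boolean algebra, where $\bigvee_{i\in I}A_i=(\bigcup_{i\in I}A_i)^{\perp\perp}$ and the complement of $A$ is $A^\perp$.
   Context: A bounded lattice $(L,\vee,\wedge,0,1)$ is pseudocomplemented if for every $x\in L$ there is a greatest element $x^*\in L$ with $x\wedge x^*=0$; thus $x\wedge y=0$ iff $y\le x^*$. The orthogonality relation is $x\perp y$ iff $x\wedge y=0$ (equivalently $y\le x^*$). For $A\subseteq L$ put $A^\perp:=\{x\in L\mid x\perp y\text{ for all }y\in A\}$. A subset $A$ is closed if $A^{\perp\perp}=A$, and $\mathrm{Cl}(\mathbf L)$ denotes the set of all closed subsets of $L$, ordered by inclusion. *)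

theory Defs
  imports "HOL-Algebra.Complete_Lattice"
begin

locale pseudocomplemented_lattice = bounded_lattice L for L (structure) +
  fixes pcompl :: "'a \<Rightarrow> 'a"
  assumes pcompl_greatest:
    "x \<in> carrier L \<Longrightarrow> greatest L (pcompl x) {y \<in> carrier L. x \<sqinter> y = \<bottom>}"

locale complete_pseudocomplemented_lattice =
  complete_lattice L + pseudocomplemented_lattice L pcompl
  for L (structure) and pcompl

locale boolean_lattice = bounded_lattice L for L (structure) +
  fixes compl :: "'a \<Rightarrow> 'a"
  assumes meet_join_distrib:
    "\<lbrakk>x \<in> carrier L; y \<in> carrier L; z \<in> carrier L\<rbrakk>
      \<Longrightarrow> x \<sqinter> (y \<squnion> z) = (x \<sqinter> y) \<squnion> (x \<sqinter> z)"
    and compl_closed: "x \<in> carrier L \<Longrightarrow> compl x \<in> carrier L"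
    and meet_compl: "x \<in> carrier L \<Longrightarrow> x \<sqinter> compl x = \<bottom>"
    and join_compl: "x \<in> carrier L \<Longrightarrow> x \<squnion> compl x = \<top>"

locale complete_boolean_lattice =
  complete_lattice L + boolean_lattice L compl
  for L (structure) and compl

definition orthogonal :: "('a, 'b) gorder_scheme \<Rightarrow> 'a \<Rightarrow> 'a \<Rightarrow> bool"
  where "orthogonal L x y \<longleftrightarrow> x \<sqinter>\<^bsub>L\<^esub> y = \<bottom>\<^bsub>L\<^esub>"

definition perp :: "('a, 'b) gorder_scheme \<Rightarrow> 'a set \<Rightarrow> 'a set"
  where "perp L A = {x \<in> carrier L. \<forall>y\<in>A. orthogonal L x y}"

definition closed_sets :: "('a, 'b) gorder_scheme \<Rightarrow> 'a set set"
  where "closed_sets L = {A. A \<subseteq> carrier L \<and> perp L (perp L A) = A}"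

definition Cl :: "('a, 'b) gorder_scheme \<Rightarrow> 'a set gorder"
  where "Cl L = \<lparr>carrier = closed_sets L, eq = (=), le = (\<subseteq>)\<rparr>"

end

theory Submission
  imports Defs
begin

text \<open>
  The map \<open>A \<mapsto> A\<^sup>\<bottom>\<close> forms a Galois connection of the power set with itself, so the closed sets are
  a complete lattice with intersections as meets, and \<open>A\<^sup>\<bottom>\<close> complements \<open>A\<close> because only \<open>0\<close> is
  orthogonal to itself. Distributivity uses that closed sets are down-sets: suppose
  \<open>x \<in> A \<inter> (B \<or> C)\<close> and \<open>y\<close> is orthogonal to \<open>A \<inter> B\<close> and to \<open>A \<inter> C\<close>, and put \<open>z = x \<and> y\<close>. For
  \<open>b \<in> B\<close> the element \<open>z \<and> b\<close> lies below \<open>y\<close> and in \<open>A \<inter> B\<close>, so it is \<open>0\<close>; likewise for \<open>C\<close>. Hence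
  \<open>z\<close> lies both in \<open>(B \<union> C)\<^sup>\<bottom>\<close> and in \<open>(B \<union> C)\<^sup>\<bottom>\<^sup>\<bottom>\<close>, so \<open>z = 0\<close>.
\<close>

section \<open>Orthogonality of elements\<close>

context bounded_lattice
begin

text \<open>The meet is the greatest common lower bound, so it is \<open>\<bottom>\<close> exactly
  if every common lower bound is. This lets later proofs treat orthogonality through the order
  alone.\<close>

lemma orthogonal_iff:
  assumes "x \<in> carrier L" "y \<in> carrier L"
  shows "orthogonal L x y \<longleftrightarrow> (\<forall>z\<in>carrier L. z \<sqsubseteq> x \<longrightarrow> z \<sqsubseteq> y \<longrightarrow> z = \<bottom>)"
proof
  assume "orthogonal L x y"
  then show "\<forall>z\<in>carrier L. z \<sqsubseteq> x \<longrightarrow> z \<sqsubseteq> y \<longrightarrow> z = \<bottom>"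
    using assms by (metis orthogonal_def meet_le bottom_lower bottom_closed le_antisym)
next
  assume "\<forall>z\<in>carrier L. z \<sqsubseteq> x \<longrightarrow> z \<sqsubseteq> y \<longrightarrow> z = \<bottom>"
  then show "orthogonal L x y"
    using assms by (simp add: orthogonal_def meet_left meet_right)
qed

lemma orthogonal_self: "\<lbrakk>x \<in> carrier L; orthogonal L x x\<rbrakk> \<Longrightarrow> x = \<bottom>"
  using orthogonal_iff[of x x] by simp

lemma orthogonal_bottom: "x \<in> carrier L \<Longrightarrow> orthogonal L x \<bottom>"
  using orthogonal_iff[of x \<bottom>] by (simp add: le_antisym)

lemma orthogonal_commute: "orthogonal L x y \<longleftrightarrow> orthogonal L y x"
  by (simp add: orthogonal_def meet_comm)

lemma orthogonal_mono_left:
  assumes "orthogonal L x y" "z \<sqsubseteq> x" "x \<in> carrier L" "y \<in> carrier L" "z \<in> carrier L"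
  shows "orthogonal L z y"
  using assms orthogonal_iff[of x y] orthogonal_iff[of z y] by (meson le_trans)

section \<open>The Galois connection and its closed sets\<close>

lemma perp_subset_carrier: "perp L A \<subseteq> carrier L"
  by (auto simp: perp_def)

lemma perp_antimono: "A \<subseteq> B \<Longrightarrow> perp L B \<subseteq> perp L A"
  by (auto simp: perp_def)

lemma perp_perp_extensive: "A \<subseteq> carrier L \<Longrightarrow> A \<subseteq> perp L (perp L A)"
  by (auto simp: perp_def orthogonal_commute)

text \<open>The usual triangle identity: one inclusion is extensivity at \<open>perp L A\<close>,
  the other is antitonicity applied to extensivity at \<open>A\<close>.\<close>

lemma perp_perp_perp: "A \<subseteq> carrier L \<Longrightarrow> perp L (perp L (perp L A)) = perp L A"
  by (intro subset_antisym perp_antimono perp_perp_extensive perp_subset_carrier)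

lemma perp_in_closed_sets: "A \<subseteq> carrier L \<Longrightarrow> perp L A \<in> closed_sets L"
  by (simp add: closed_sets_def perp_perp_perp perp_subset_carrier)

lemma perp_perp_least:
  assumes "A \<subseteq> B" "B \<in> closed_sets L"
  shows "perp L (perp L A) \<subseteq> B"
  using assms perp_antimono[OF perp_antimono[OF assms(1)]] by (simp add: closed_sets_def)

text \<open>A common element is orthogonal to itself. For closed \<open>A\<close> this says that
  \<open>A\<close> and \<open>perp L A\<close> meet in \<open>{\<bottom>}\<close>; for other
  \<open>A\<close> it ends the distributivity proof.\<close>

lemma perp_inter_perp_perp: "perp L A \<inter> perp L (perp L A) = {\<bottom>}" if "A \<subseteq> carrier L"
proof
  show "perp L A \<inter> perp L (perp L A) \<subseteq> {\<bottom>}"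
    using orthogonal_self by (auto simp: perp_def)
  show "{\<bottom>} \<subseteq> perp L A \<inter> perp L (perp L A)"
    using that orthogonal_bottom orthogonal_commute by (auto simp: perp_def)
qed

lemma perp_bottom: "perp L {\<bottom>} = carrier L"
  using orthogonal_bottom by (auto simp: perp_def)

lemma perp_carrier: "perp L (carrier L) = {\<bottom>}"
  using perp_inter_perp_perp[of "{\<bottom>}"] perp_subset_carrier[of "carrier L"]
  by (auto simp: perp_bottom)

lemma carrier_closed: "carrier L \<in> closed_sets L"
  by (simp add: closed_sets_def perp_carrier perp_bottom)

lemma bottom_set_closed: "{\<bottom>} \<in> closed_sets L"
  by (simp add: closed_sets_def perp_carrier perp_bottom)

text \<open>Membership in \<open>A = perp L (perp L A)\<close> means orthogonality to all of
  \<open>perp L A\<close>, and orthogonality passes to smaller elements.\<close>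

lemma closed_sets_down:
  assumes "A \<in> closed_sets L" "x \<in> A" "z \<sqsubseteq> x" "z \<in> carrier L"
  shows "z \<in> A"
proof -
  have closed: "perp L (perp L A) = A" and x: "x \<in> carrier L"
    using assms by (auto simp: closed_sets_def)
  have "orthogonal L z y" if "y \<in> perp L A" for y
  proof (rule orthogonal_mono_left[OF _ assms(3) x _ assms(4)])
    show "orthogonal L x y"
      using that assms(2) by (simp add: perp_def orthogonal_commute)
    show "y \<in> carrier L"
      using that perp_subset_carrier by blast
  qed
  then have "z \<in> perp L (perp L A)"
    using assms(4) by (simp add: perp_def[of L "perp L A"])
  then show ?thesis
    by (simp add: closed)
qed

text \<open>The factor \<open>carrier L\<close> matters for the empty family, where
  \<open>\<Inter>\<A>\<close> is the whole type.\<close>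

lemma Inter_closed:
  assumes "\<A> \<subseteq> closed_sets L"
  shows "carrier L \<inter> \<Inter>\<A> \<in> closed_sets L"
proof -
  have "perp L (perp L (carrier L \<inter> \<Inter>\<A>)) \<subseteq> B" if "B \<in> \<A>" for B
    using that assms by (intro perp_perp_least) auto
  then have "perp L (perp L (carrier L \<inter> \<Inter>\<A>)) \<subseteq> carrier L \<inter> \<Inter>\<A>"
    using perp_subset_carrier by blast
  then show ?thesis
    using perp_perp_extensive[of "carrier L \<inter> \<Inter>\<A>"] by (auto simp: closed_sets_def)
qed

section \<open>Completeness and the lattice operations of \<open>Cl L\<close>\<close>

lemma partial_order_Cl: "partial_order (Cl L)"
  by standard (auto simp: Cl_def)

lemma lub_Cl:
  assumes "\<A> \<subseteq> closed_sets L"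
  shows "least (Cl L) (perp L (perp L (\<Union>\<A>))) (Upper (Cl L) \<A>)"
proof (rule least_UpperI)
  have "\<Union>\<A> \<subseteq> carrier L"
    using assms by (auto simp: closed_sets_def)
  then show "B \<sqsubseteq>\<^bsub>Cl L\<^esub> perp L (perp L (\<Union>\<A>))" if "B \<in> \<A>" for B
    using that perp_perp_extensive[of "\<Union>\<A>"] by (auto simp: Cl_def)
  show "perp L (perp L (\<Union>\<A>)) \<sqsubseteq>\<^bsub>Cl L\<^esub> B" if "B \<in> Upper (Cl L) \<A>" for B
    using that assms perp_perp_least[of "\<Union>\<A>" B] by (auto simp: Upper_def Cl_def)
  show "\<A> \<subseteq> carrier (Cl L)" "perp L (perp L (\<Union>\<A>)) \<in> carrier (Cl L)"
    using assms by (simp_all add: Cl_def perp_in_closed_sets perp_subset_carrier)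
qed

lemma glb_Cl:
  assumes "\<A> \<subseteq> closed_sets L"
  shows "greatest (Cl L) (carrier L \<inter> \<Inter>\<A>) (Lower (Cl L) \<A>)"
proof (rule greatest_LowerI)
  show "B \<sqsubseteq>\<^bsub>Cl L\<^esub> carrier L \<inter> \<Inter>\<A>" if "B \<in> Lower (Cl L) \<A>" for B
    using that assms by (fastforce simp: Lower_def Cl_def closed_sets_def)
  show "\<A> \<subseteq> carrier (Cl L)" "carrier L \<inter> \<Inter>\<A> \<in> carrier (Cl L)"
    using assms by (simp_all add: Cl_def Inter_closed)
qed (auto simp: Cl_def)

lemma complete_lattice_Cl: "complete_lattice (Cl L)"
proof (rule partial_order.complete_latticeI[OF partial_order_Cl])
  fix \<A> assume "\<A> \<subseteq> carrier (Cl L)"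
  then have "\<A> \<subseteq> closed_sets L"
    by (simp add: Cl_def)
  then show "\<exists>s. least (Cl L) s (Upper (Cl L) \<A>)" "\<exists>i. greatest (Cl L) i (Lower (Cl L) \<A>)"
    using lub_Cl glb_Cl by blast+
qed

text \<open>The supremum is defined by choice, so its value follows from \<open>lub_Cl\<close>
  together with uniqueness of least elements. Infimum, bottom and top are computed in the same
  way.\<close>

lemma sup_Cl:
  assumes "\<A> \<subseteq> closed_sets L"
  shows "\<Squnion>\<^bsub>Cl L\<^esub> \<A> = perp L (perp L (\<Union>\<A>))"
  unfolding sup_def
  by (rule some_equality, rule lub_Cl[OF assms],
      erule partial_order.least_unique[OF partial_order_Cl _ lub_Cl[OF assms]])

lemma join_Cl:
  "\<lbrakk>A \<in> closed_sets L; B \<in> closed_sets L\<rbrakk> \<Longrightarrow> A \<squnion>\<^bsub>Cl L\<^esub> B = perp L (perp L (A \<union> B))"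
  by (simp add: join_def sup_Cl)

lemma inf_Cl:
  assumes "\<A> \<subseteq> closed_sets L"
  shows "\<Sqinter>\<^bsub>Cl L\<^esub> \<A> = carrier L \<inter> \<Inter>\<A>"
  unfolding inf_def
  by (rule some_equality, rule glb_Cl[OF assms],
      erule partial_order.greatest_unique[OF partial_order_Cl _ glb_Cl[OF assms]])

lemma meet_Cl:
  "\<lbrakk>A \<in> closed_sets L; B \<in> closed_sets L\<rbrakk> \<Longrightarrow> A \<sqinter>\<^bsub>Cl L\<^esub> B = A \<inter> B"
  using inf_Cl[of "{A, B}"] by (auto simp: meet_def closed_sets_def)

lemma bottom_Cl: "\<bottom>\<^bsub>Cl L\<^esub> = {\<bottom>}"
proof -
  have "{\<bottom>} \<subseteq> A" if "A \<in> closed_sets L" for A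
    \<comment> \<open>\<open>{\<bottom>}\<close> is the closure of the empty set:
      \<open>perp L {}\<close> is the carrier, and \<open>perp L (carrier L)\<close> is
      \<open>{\<bottom>}\<close>.\<close>
    using perp_perp_least[of "{}" A] that by (simp add: perp_def[of L "{}"] perp_carrier)
  then have *: "least (Cl L) {\<bottom>} (carrier (Cl L))"
    by (auto simp: least_def Cl_def bottom_set_closed)
  show ?thesis
    unfolding bottom_def[of "Cl L"]
    by (rule some_equality, rule *, erule partial_order.least_unique[OF partial_order_Cl _ *])
qed

lemma top_Cl: "\<top>\<^bsub>Cl L\<^esub> = carrier L"
proof -
  have *: "greatest (Cl L) (carrier L) (carrier (Cl L))"
    using carrier_closed by (auto simp: greatest_def Cl_def closed_sets_def)
  show ?thesis
    unfolding top_def[of "Cl L"]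
    by (rule some_equality, rule *, erule partial_order.greatest_unique[OF partial_order_Cl _ *])
qed

section \<open>Distributivity and complements\<close>

lemma closed_sets_inter:
  "\<lbrakk>A \<in> closed_sets L; B \<in> closed_sets L\<rbrakk> \<Longrightarrow> A \<inter> B \<in> closed_sets L"
  using Inter_closed[of "{A, B}"] inf_Cl[of "{A, B}"] meet_Cl[of A B] by (simp add: meet_def)

lemma closed_sets_distrib:
  assumes A: "A \<in> closed_sets L" and B: "B \<in> closed_sets L" and C: "C \<in> closed_sets L"
  shows "A \<inter> perp L (perp L (B \<union> C)) = perp L (perp L (A \<inter> B \<union> A \<inter> C))"
proof
  have sub: "A \<subseteq> carrier L" "B \<subseteq> carrier L" "C \<subseteq> carrier L"
    using assms by (auto simp: closed_sets_def)
  \<comment> \<open>The right side of this inclusion is closed, so it suffices that it contains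
    \<open>A \<inter> B\<close> and \<open>A \<inter> C\<close>.\<close>
  show "perp L (perp L (A \<inter> B \<union> A \<inter> C)) \<subseteq> A \<inter> perp L (perp L (B \<union> C))"
    using sub A perp_perp_extensive[of "B \<union> C"]
    by (intro perp_perp_least closed_sets_inter perp_in_closed_sets perp_subset_carrier) auto
  show "A \<inter> perp L (perp L (B \<union> C)) \<subseteq> perp L (perp L (A \<inter> B \<union> A \<inter> C))"
  proof
    fix x assume x: "x \<in> A \<inter> perp L (perp L (B \<union> C))"
    then have xc: "x \<in> carrier L" using sub by auto
    have "orthogonal L x y" if y: "y \<in> perp L (A \<inter> B \<union> A \<inter> C)" for y
    proof -
      have yc: "y \<in> carrier L" using y perp_subset_carrier by blast
      define z where "z = x \<sqinter> y"
      have z: "z \<in> carrier L" "z \<sqsubseteq> x" "z \<sqsubseteq> y"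
        using xc yc by (auto simp: z_def meet_left meet_right)
      \<comment> \<open>\<open>D\<close> stands for \<open>B\<close> or \<open>C\<close>, so both
        cases are done at once. By \<open>orthogonal_iff\<close>, an arbitrary common lower bound
        \<open>w\<close> replaces the meet of \<open>z\<close> and \<open>d\<close>.\<close>
      have "orthogonal L z d" if d: "d \<in> D" and D: "D \<in> {B, C}" for d D
      proof -
        have dc: "d \<in> carrier L" using d D sub by auto
        have Dcl: "D \<in> closed_sets L" using D B C by auto
        have "w = \<bottom>" if w: "w \<in> carrier L" "w \<sqsubseteq> z" "w \<sqsubseteq> d" for w
        proof -
          have "w \<sqsubseteq> x" "w \<sqsubseteq> y" using w z xc yc by (blast intro: le_trans)+
          moreover have "w \<in> A \<inter> D"
            using closed_sets_down[OF A] closed_sets_down[OF Dcl] x d w \<open>w \<sqsubseteq> x\<close> by blast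
          then have "orthogonal L y w" using y D by (auto simp: perp_def)
          ultimately show ?thesis
            \<comment> \<open>\<open>w\<close> is below both members of the orthogonal pair
              \<open>y\<close>, \<open>w\<close>.\<close>
            using orthogonal_iff[OF yc w(1)] w(1) by auto
        qed
        then show ?thesis using orthogonal_iff[OF z(1) dc] by blast
      qed
      then have "z \<in> perp L (B \<union> C)" using z(1) by (auto simp: perp_def)
      \<comment> \<open>This closure is a down-set containing \<open>x\<close>, and \<open>z\<close>
        lies below \<open>x\<close>.\<close>
      moreover have "z \<in> perp L (perp L (B \<union> C))"
        using closed_sets_down[OF perp_in_closed_sets[OF perp_subset_carrier]] x z by blast
      ultimately have "z = \<bottom>"
        using perp_inter_perp_perp[of "B \<union> C"] sub by blast
      then show ?thesis by (simp add: orthogonal_def z_def)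
    qed
    then show "x \<in> perp L (perp L (A \<inter> B \<union> A \<inter> C))"
      using xc by (simp add: perp_def[of L "perp L _"])
  qed
qed

lemma complete_boolean_lattice_Cl: "complete_boolean_lattice (Cl L) (perp L)"
proof -
  interpret Cl: complete_lattice "Cl L"
    by (rule complete_lattice_Cl)
  have carrier_Cl: "carrier (Cl L) = closed_sets L"
    by (simp add: Cl_def)
  show ?thesis
  proof
    fix A B C
    assume A: "A \<in> carrier (Cl L)" and B: "B \<in> carrier (Cl L)" and C: "C \<in> carrier (Cl L)"
    then show "A \<sqinter>\<^bsub>Cl L\<^esub> (B \<squnion>\<^bsub>Cl L\<^esub> C) = A \<sqinter>\<^bsub>Cl L\<^esub> B \<squnion>\<^bsub>Cl L\<^esub> (A \<sqinter>\<^bsub>Cl L\<^esub> C)"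
      by (simp add: carrier_Cl join_Cl meet_Cl closed_sets_inter perp_in_closed_sets
          perp_subset_carrier closed_sets_distrib)
  next
    fix A assume A: "A \<in> carrier (Cl L)"
    then have sub: "A \<subseteq> carrier L" and cl: "A \<in> closed_sets L" "perp L (perp L A) = A"
      by (auto simp: Cl_def closed_sets_def)
    show closed: "perp L A \<in> carrier (Cl L)"
      using sub by (simp add: carrier_Cl perp_in_closed_sets)
    show "A \<sqinter>\<^bsub>Cl L\<^esub> perp L A = \<bottom>\<^bsub>Cl L\<^esub>"
      using closed cl perp_inter_perp_perp[OF sub]
      by (simp add: carrier_Cl meet_Cl bottom_Cl inf_commute)
    \<comment> \<open>De Morgan: the right side is \<open>{\<bottom>}\<close>, so one more
      \<open>perp\<close> gives the whole carrier as the join.\<close>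
    have "perp L (A \<union> perp L A) = perp L A \<inter> perp L (perp L A)"
      by (auto simp: perp_def)
    then show "A \<squnion>\<^bsub>Cl L\<^esub> perp L A = \<top>\<^bsub>Cl L\<^esub>"
      using closed cl perp_inter_perp_perp[OF sub]
      by (simp add: carrier_Cl join_Cl top_Cl perp_bottom)
  qed
qed

end

theorem theorem4:
  fixes L :: "('a, 'b) gorder_scheme" and pcompl :: "'a \<Rightarrow> 'a"
  assumes "complete_pseudocomplemented_lattice L pcompl"
  shows "complete_boolean_lattice (Cl L) (perp L)
    \<and> (\<forall>(I :: 'i set) A. (\<forall>i\<in>I. A i \<in> closed_sets L) \<longrightarrow>
          \<Squnion>\<^bsub>Cl L\<^esub> (A ` I) = perp L (perp L (\<Union>i\<in>I. A i)))
    \<and> (\<forall>A\<in>closed_sets L. \<forall>B\<in>closed_sets L. A \<squnion>\<^bsub>Cl L\<^esub> B = perp L (perp L (A \<union> B)))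
    \<and> (\<forall>A\<in>closed_sets L. \<forall>B\<in>closed_sets L. A \<sqinter>\<^bsub>Cl L\<^esub> B = A \<inter> B)
    \<and> \<bottom>\<^bsub>Cl L\<^esub> = {\<bottom>\<^bsub>L\<^esub>}
    \<and> \<top>\<^bsub>Cl L\<^esub> = carrier L"
proof -
  interpret complete_pseudocomplemented_lattice L pcompl
    by (fact assms)
  show ?thesis
    by (simp add: complete_boolean_lattice_Cl sup_Cl image_subset_iff join_Cl meet_Cl bottom_Cl top_Cl)
qed

end
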